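(* Let $\mathcal{S}$ be a semi-primitive linear subspace of $\mathrm{Mat}_{m,n}(\mathbb{K})$. Set $r:=\mathrm{urk}(\mathcal{S})$ and assume $\#\mathbb{K}>r\geq 2$. Then $\mathrm{trk}(\mathcal{S})\leq 6+\binom{r-2}{2}$.
   Context: $\mathrm{urk}$ is the maximal rank of a matrix in the space; $\mathrm{trk}(\mathcal{S}):=\max_{x\in\mathbb{K}^n}\dim\{Mx\mid M\in\mathcal{S}\}$. For an operator space $\mathcal{T}\subseteq\mathcal{L}(U,V)$: $\mathcal{T}$ is reduced if $\bigcap_{f\in\mathcal{T}}\ker f=\{0\}$ and $\sum_{f\in\mathcal{T}}\mathrm{im} f=V$; $\mathcal{T}$ is $c$-defective if $\dim\ker f\geq c$ for all $f\in\mathcal{T}$; its defectiveness index is the greatest such $c$; $\mathcal{T}$ is semi-primitive if it is reduced and there is no linear hyperplane $U'$ of $U$ such that $\{f_{|U'}\mid f\in\mathcal{T}\}$ is $c$-defective, $c$ being the defectiveness index of $\mathcal{T}$. A matrix space in $\mathrm{Mat}_{m,n}(\mathbb{K})$ is semi-primitive if the corresponding subspace of $\mathcal{L}(\mathbb{K}^n,\mathbb{K}^m)$ is. *)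

theory Defs
  imports "HOL-Analysis.Analysis"
begin

text \<open>Matrices in Mat_{m,n}(K) are elements of type 'a^'n^'m ('a a field),
 acting on column vectors 'a^'n by (*v).  The corresponding operator of a
 matrix A is the linear map x |-> A *v x from K^n to K^m.\<close>

definition mat_smult :: "'a::field \<Rightarrow> 'a^'n^'m \<Rightarrow> 'a^'n^'m" where
  "mat_smult c A = (\<chi> i j. c * A $ i $ j)"

definition matrix_subspace :: "('a::field^'n^'m) set \<Rightarrow> bool" where
  "matrix_subspace S \<longleftrightarrow> 0 \<in> S \<and> (\<forall>A\<in>S. \<forall>B\<in>S. A + B \<in> S)
     \<and> (\<forall>c. \<forall>A\<in>S. mat_smult c A \<in> S)"

definition mker :: "'a::field^'n^'m \<Rightarrow> ('a^'n) set" where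
  "mker A = {x. A *v x = 0}"

definition urk :: "('a::field^'n^'m) set \<Rightarrow> nat" where
  "urk S = Max {rank A | A. A \<in> S}"

definition trk :: "('a::field^'n^'m) set \<Rightarrow> nat" where
  "trk S = Max {vec.dim {A *v x | A. A \<in> S} | x. True}"

definition reduced :: "('a::field^'n^'m) set \<Rightarrow> bool" where
  "reduced S \<longleftrightarrow> (\<Inter>A\<in>S. mker A) = {0} \<and> vec.span (\<Union>A\<in>S. range (\<lambda>x. A *v x)) = UNIV"

definition defective :: "('a::field^'n^'m) set \<Rightarrow> nat \<Rightarrow> bool" where
  "defective S c \<longleftrightarrow> (\<forall>A\<in>S. vec.dim (mker A) \<ge> c)"

definition defectiveness_index :: "('a::field^'n^'m) set \<Rightarrow> nat" where
  "defectiveness_index S = (GREATEST c. defective S c)"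

text \<open>The restriction of x |-> A x to a subspace U' has kernel mker A \<inter> U'.
 So {f|U'} is c-defective iff every A in S has dim (mker A \<inter> U') \<ge> c.\<close>
definition restricted_defective :: "('a::field^'n^'m) set \<Rightarrow> ('a^'n) set \<Rightarrow> nat \<Rightarrow> bool" where
  "restricted_defective S U c \<longleftrightarrow> (\<forall>A\<in>S. vec.dim (mker A \<inter> U) \<ge> c)"

definition linear_hyperplane :: "('a::field^'n) set \<Rightarrow> bool" where
  "linear_hyperplane U \<longleftrightarrow> vec.subspace U \<and> vec.dim U + 1 = CARD('n)"

definition semi_primitive :: "('a::field^'n^'m) set \<Rightarrow> bool" where
  "semi_primitive S \<longleftrightarrow> reduced S \<and>
     \<not> (\<exists>U. linear_hyperplane U \<and> restricted_defective S U (defectiveness_index S))"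

end

theory Submission
  imports Defs "HOL-Computational_Algebra.Fraction_Field"
begin

text \<open>Semi-primitivity makes the vectors \<open>z\<close> killed by some \<open>M\<close> in \<open>S\<close> of rank \<open>r\<close> span
  \<open>K\<^sup>n\<close>. Extending scalars to \<open>K(t)\<close> (where \<open>#K > r\<close> keeps the upper rank equal to \<open>r\<close>), assume \<open>K\<close>
  infinite. For a pair \<open>(M, z)\<close> and \<open>N\<close> in \<open>S\<close>, the kernel of \<open>M + tN\<close> contains a curve through \<open>z\<close>, rational
  in \<open>t\<close>. Hence \<open>Sz\<close> lies in the image of \<open>M\<close>, and the tangent directions at \<open>z\<close> of such curves fill
  the space \<open>T = {u. Mu \<in> Sz}\<close>, of dimension \<open>n - r + dim Sz\<close>. Let \<open>d \<le> r\<close> be the largest \<open>dim Sz\<close>.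
  Starting from a pair that attains \<open>d\<close>, some \<open>k \<le> r + 1 - d\<close> of the spaces \<open>T\<close> sum up to \<open>K\<^sup>n\<close>, so, as
  with Terracini's lemma, the sums of \<open>k\<close> kernel vectors are Zariski dense. Since \<open>dim Sx \<le> kd\<close> for such
  a sum \<open>x\<close>, this holds for every \<open>x\<close>, and the integer part of
  \<open>(r + 1)\<^sup>2/4 \<ge> kd\<close> does not exceed the claimed bound.\<close>

subsection \<open>Dimension and rank over an arbitrary field\<close>

text \<open>Rank-nullity on \<open>V\<close>, one inequality at a time. If a basis \<open>B\<close>
  of the kernel is extended to a basis \<open>C\<close> of \<open>V\<close>, the images of
  \<open>C - B\<close> span the image of \<open>V\<close>. A linear right inverse \<open>g\<close>
  splits each \<open>v\<close> into a kernel element and \<open>g (f v)\<close>, which gives the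
  other inequality.\<close>

lemma vec_dim_kernel_image:
  fixes f :: "'a::field^'n \<Rightarrow> 'a^'m"
  assumes f: "Vector_Spaces.linear (*s) (*s) f" and V: "vec.subspace V"
  shows "vec.dim {v \<in> V. f v = 0} + vec.dim (f ` V) = vec.dim V"
proof -
  interpret f: Vector_Spaces.linear "(*s)" "(*s)" f by (rule f)
  let ?N = "{v \<in> V. f v = 0}"
  obtain B where B: "B \<subseteq> ?N" "vec.independent B" "?N \<subseteq> vec.span B" "card B = vec.dim ?N"
    using vec.basis_exists by blast
  obtain C where C: "B \<subseteq> C" "C \<subseteq> V" "vec.independent C" "V \<subseteq> vec.span C"
    using vec.maximal_independent_subset_extend[of B V] B by blast
  have fin: "finite C" "finite B"
    using C B by (auto intro: vec.finiteI_independent)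
  have cardC: "card C = vec.dim V" using C by (intro vec.basis_card_eq_dim)
  have "f ` C \<subseteq> insert 0 (f ` (C - B))" using B(1) by auto
  then have "vec.span (f ` C) \<subseteq> vec.span (f ` (C - B))"
    by (metis vec.span_insert_0 vec.span_mono)
  moreover have "f ` V \<subseteq> vec.span (f ` C)"
    using C(4) f.span_image by blast
  ultimately have "vec.dim (f ` V) \<le> card (f ` (C - B))"
    using fin by (intro vec.dim_le_card) auto
  also have "\<dots> \<le> card (C - B)" using fin by (intro card_image_le) auto
  also have "\<dots> = vec.dim V - vec.dim ?N"
    using fin C(1) B(4) cardC by (simp add: card_Diff_subset)
  finally have le: "vec.dim (f ` V) + vec.dim ?N \<le> vec.dim V"
    using vec.dim_subset[of ?N V] by auto
  obtain E where E: "E \<subseteq> f ` V" "vec.independent E" "f ` V \<subseteq> vec.span E" "card E = vec.dim (f ` V)"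
    using vec.basis_exists by blast
  have finE: "finite E" using E(2) by (rule vec.finiteI_independent)
  obtain g where g: "range g \<subseteq> V" "Vector_Spaces.linear (*s) (*s) g" "\<forall>v\<in>f ` V. f (g v) = v"
    using vec.linear_exists_right_inverse_on[OF f V] by blast
  interpret g: Vector_Spaces.linear "(*s)" "(*s)" g by (rule g)
  have "V \<subseteq> vec.span (B \<union> g ` E)"
  proof
    fix v assume v: "v \<in> V"
    have "v - g (f v) \<in> ?N"
      using v g(1,3) by (auto simp: f.diff intro: vec.subspace_diff[OF V])
    then have 1: "v - g (f v) \<in> vec.span (B \<union> g ` E)"
      using B(3) vec.span_mono[of B "B \<union> g ` E"] by blast
    have "g (f v) \<in> vec.span (g ` E)"
      using E(3) v g.span_image by blast
    then have 2: "g (f v) \<in> vec.span (B \<union> g ` E)"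
      using vec.span_mono[of "g ` E" "B \<union> g ` E"] by blast
    show "v \<in> vec.span (B \<union> g ` E)" using vec.span_add[OF 1 2] by simp
  qed
  then have "vec.dim V \<le> card (B \<union> g ` E)"
    using fin finE by (intro vec.dim_le_card) auto
  also have "\<dots> \<le> card B + card (g ` E)" by (rule card_Un_le)
  also have "\<dots> \<le> card B + card E" using finE by (simp add: card_image_le)
  finally show ?thesis using le B(4) E(4) by simp
qed

text \<open>\<open>rank\<close> is the row rank. Writing the rows in a basis \<open>R\<close> of the
  row space factors \<open>A\<close> through a space of dimension \<open>card R\<close>. Used for
  \<open>A\<close> and its transpose, this yields equality of row and column rank in
  \<open>rank_eq_dim_range\<close>.\<close>

lemma vec_dim_range_le_rank:
  fixes A :: "'a::field^'n^'m"
  shows "vec.dim (range ((*v) A)) \<le> rank A"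
proof -
  obtain R where R: "R \<subseteq> rows A" "vec.independent R" "rows A \<subseteq> vec.span R" "card R = vec.dim (rows A)"
    using vec.basis_exists by blast
  have finR: "finite R" using R(2) by (rule vec.finiteI_independent)
  have "\<exists>c. row i A = (\<Sum>b\<in>R. c b *s b)" for i
    using R(3) vec.span_finite[OF finR] by (auto simp: rows_def)
  then obtain c where c: "\<And>i. row i A = (\<Sum>b\<in>R. c i b *s b)" by metis
  let ?W = "(\<lambda>b. \<chi> i. c i b) ` R"
  have "range ((*v) A) \<subseteq> vec.span ?W"
  proof
    fix y assume "y \<in> range ((*v) A)"
    then obtain x where y: "y = A *v x" by auto
    have "y $ i = (\<Sum>b\<in>R. (\<Sum>j\<in>UNIV. b $ j * x $ j) * c i b)" for i
    proof -
      have "y $ i = (\<Sum>j\<in>UNIV. row i A $ j * x $ j)"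
        by (simp add: y matrix_vector_mult_def row_def)
      also have "\<dots> = (\<Sum>j\<in>UNIV. \<Sum>b\<in>R. c i b * b $ j * x $ j)"
        by (simp add: c sum_component sum_distrib_right)
      also have "\<dots> = (\<Sum>b\<in>R. \<Sum>j\<in>UNIV. c i b * b $ j * x $ j)" by (rule sum.swap)
      finally show ?thesis by (simp add: sum_distrib_left mult_ac)
    qed
    then have "y = (\<Sum>b\<in>R. (\<Sum>j\<in>UNIV. b $ j * x $ j) *s (\<chi> i. c i b))"
      by (simp add: vec_eq_iff sum_component)
    also have "\<dots> \<in> vec.span ?W"
      by (intro vec.span_sum vec.span_scale vec.span_base) auto
    finally show "y \<in> vec.span ?W" .
  qed
  then have "vec.dim (range ((*v) A)) \<le> card ?W" using finR by (intro vec.dim_le_card) auto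
  also have "\<dots> \<le> card R" using finR by (rule card_image_le)
  finally show ?thesis using R(4) by (simp add: row_rank_def_gen)
qed

lemma mult_axis_eq_column:
  fixes A :: "'a::field^'n^'m"
  shows "A *v axis k 1 = column k A"
  by (simp add: vec_eq_iff column_def matrix_vector_mult_def axis_def if_distrib cong: if_cong)

lemma vec_dim_range_eq_columns:
  fixes A :: "'a::field^'n^'m"
  shows "vec.dim (range ((*v) A)) = vec.dim (columns A)"
proof -
  have "columns A \<subseteq> range ((*v) A)"
    by (auto simp: columns_def image_iff) (metis mult_axis_eq_column)
  moreover have "range ((*v) A) \<subseteq> vec.span (columns A)"
    unfolding matrix_mult_sum columns_def
    by (intro image_subsetI vec.span_sum vec.span_scale vec.span_base) auto
  ultimately show ?thesis
    by (metis vec.dim_span vec.dim_subset order_antisym)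
qed

lemma rank_eq_dim_range:
  fixes A :: "'a::field^'n^'m"
  shows "rank A = vec.dim (range ((*v) A))"
proof -
  have "rank A = vec.dim (range ((*v) (transpose A)))"
    by (simp only: vec_dim_range_eq_columns columns_transpose row_rank_def_gen)
  also have "\<dots> \<le> rank (transpose A)" by (rule vec_dim_range_le_rank)
  also have "\<dots> = vec.dim (range ((*v) A))"
    by (simp only: vec_dim_range_eq_columns rows_transpose row_rank_def_gen)
  finally show ?thesis using vec_dim_range_le_rank[of A] by simp
qed

lemma dim_kernel_plus_rank:
  fixes A :: "'a::field^'n^'m"
  shows "vec.dim {x. A *v x = 0} + rank A = CARD('n)"
  using vec_dim_kernel_image[of "(*v) A" UNIV]
  by (simp add: rank_eq_dim_range vec_dim_card del: vec.dim_UNIV)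

lemma dim_Union_span_le:
  fixes T :: "'i \<Rightarrow> ('a::field^'n) set"
  assumes "finite I" and "\<And>i. i \<in> I \<Longrightarrow> vec.dim (T i) \<le> d"
    and "X \<subseteq> vec.span (\<Union>i\<in>I. T i)"
  shows "vec.dim X \<le> card I * d"
proof -
  have "\<exists>B. B \<subseteq> T i \<and> vec.independent B \<and> T i \<subseteq> vec.span B \<and> card B = vec.dim (T i)" for i
    using vec.basis_exists by metis
  then obtain B where B: "\<And>i. vec.independent (B i)" "\<And>i. T i \<subseteq> vec.span (B i)" "\<And>i. card (B i) = vec.dim (T i)"
    by metis
  have fin: "finite (B i)" for i using B(1) by (rule vec.finiteI_independent)
  have "T i \<subseteq> vec.span (\<Union>i\<in>I. B i)" if "i \<in> I" for i
    using that B(2)[of i] vec.span_mono[of "B i" "\<Union>i\<in>I. B i"] by blast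
  then have "X \<subseteq> vec.span (\<Union>i\<in>I. B i)"
    using assms(3) vec.span_minimal[of "\<Union>i\<in>I. T i" "vec.span (\<Union>i\<in>I. B i)"] vec.subspace_span by blast
  then have "vec.dim X \<le> card (\<Union>i\<in>I. B i)"
    using assms(1) fin by (intro vec.dim_le_card) auto
  also have "\<dots> \<le> (\<Sum>i\<in>I. card (B i))" using assms(1) by (rule card_UN_le)
  also have "\<dots> \<le> card I * d"
    using sum_bounded_above[of I "\<lambda>i. card (B i)" d] B(3) assms(2) by simp
  finally show ?thesis .
qed

text \<open>Indexing the completed basis by \<open>'m\<close> itself makes it the rows of a square
  matrix, so that dimension bounds can be tested on determinants.\<close>

lemma exists_basis_matrix:
  fixes E :: "('a::field^'m) set"
  assumes "vec.independent E"
  shows "\<exists>e :: 'm \<Rightarrow> 'a^'m. inj e \<and> E \<subseteq> range e \<and> det (\<chi> i. e i) \<noteq> 0"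
proof -
  obtain E' where E': "E \<subseteq> E'" "vec.independent E'" "UNIV \<subseteq> vec.span E'"
    by (rule vec.maximal_independent_subset_extend[OF subset_UNIV assms]) blast
  have fin: "finite E'" using E'(2) by (rule vec.finiteI_independent)
  have "card E' = CARD('m)"
    using vec.basis_card_eq_dim[of E' UNIV] E' by (simp add: vec_dim_card del: vec.dim_UNIV)
  then obtain e where e: "bij_betw e (UNIV :: 'm set) E'"
    using fin finite_same_card_bij[of "UNIV :: 'm set" E'] by auto
  have range: "range e = E'" using bij_betw_imp_surj_on[OF e] .
  have "rows (\<chi> i. e i) = E'"
    using range by (auto simp: rows_def row_def)
  then have "det (\<chi> i. e i) \<noteq> 0"
    using E'(3) by (auto simp: invertible_det_nz[symmetric] invertible_left_inverse matrix_left_invertible_span_rows_gen)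
  then show ?thesis using bij_betw_imp_inj_on[OF e] range E'(1) by blast
qed

text \<open>Rows of an invertible matrix span the whole space, but here \<open>vec.dim W\<close>
  vectors and the rows outside \<open>I\<close> span all rows, and these are fewer than
  \<open>CARD('m)\<close>.\<close>

lemma det_rows_eq_0:
  fixes f :: "'m \<Rightarrow> 'a::field^'m"
  assumes W: "\<And>i. i \<in> I \<Longrightarrow> f i \<in> W" and lt: "vec.dim W < card I"
  shows "det (\<chi> i. f i) = 0"
proof (rule ccontr)
  assume "det (\<chi> i. f i) \<noteq> 0"
  then have span: "vec.span (rows (\<chi> i. f i)) = UNIV"
    by (simp add: invertible_det_nz[symmetric] invertible_left_inverse matrix_left_invertible_span_rows_gen)
  obtain D where D: "vec.independent D" "W \<subseteq> vec.span D" "card D = vec.dim W"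
    by (rule vec.basis_exists[of W]) blast
  have finD: "finite D" using D(1) by (rule vec.finiteI_independent)
  have "f i \<in> vec.span (D \<union> f ` (- I))" for i
  proof (cases "i \<in> I")
    case True
    then show ?thesis using W[of i] D(2) vec.span_mono[of D "D \<union> f ` (- I)"] by blast
  next
    case False
    then show ?thesis by (auto intro!: vec.span_base)
  qed
  then have "rows (\<chi> i. f i) \<subseteq> vec.span (D \<union> f ` (- I))"
    by (auto simp only: rows_def row_def vec_lambda_beta vec_lambda_eta)
  then have "UNIV \<subseteq> vec.span (D \<union> f ` (- I))"
    using span vec.span_minimal[OF _ vec.subspace_span] by blast
  then have "vec.dim (UNIV :: ('a^'m) set) \<le> card (D \<union> f ` (- I))"
    using finD by (intro vec.dim_le_card) auto
  also have "\<dots> \<le> card D + card (f ` (- I))" by (rule card_Un_le)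
  also have "\<dots> \<le> card D + card (- I)" by (simp add: card_image_le)
  finally have "CARD('m) \<le> card D + (CARD('m) - card I)"
    by (simp add: vec_dim_card Compl_eq_Diff_UNIV card_Diff_subset del: vec.dim_UNIV)
  moreover have "card I \<le> CARD('m)" by (rule card_mono) auto
  ultimately show False using lt D(3) by linarith
qed

text \<open>\<open>G\<close> picks, linearly, a preimage of each vector in the image of
  \<open>M\<close>. So \<open>M ** G\<close> fixes that image, and membership in it becomes a linear
  equation.\<close>

lemma exists_generalized_inverse:
  fixes M :: "'a::field^'n^'m"
  shows "\<exists>G. M ** G ** M = M"
proof -
  obtain g where g: "Vector_Spaces.linear (*s) (*s) g" "\<forall>v\<in>range ((*v) M). M *v (g v) = v"
    using vec.linear_exists_right_inverse_on[of "(*v) M" UNIV] by auto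
  have "M ** matrix g ** M = M"
    by (simp add: matrix_eq matrix_works[OF g(1)] g(2) flip: matrix_vector_mul_assoc)
  then show ?thesis ..
qed

subsection \<open>Rational functions regular at zero\<close>

text \<open>A rational function without pole at 0, encoded as a plain function. Its values at the
  roots of \<open>q\<close> are left free, so divisions may fail at finitely many points; since
  \<open>poly q 0\<close> is nonzero, the value at 0 is still prescribed.\<close>

definition regular_at_0 :: "('a::field \<Rightarrow> 'a) \<Rightarrow> bool" where
  "regular_at_0 f \<longleftrightarrow>
    (\<exists>p q. poly q 0 \<noteq> 0 \<and> (\<forall>t. poly q t \<noteq> 0 \<longrightarrow> f t = poly p t / poly q t))"

lemma regular_at_0I:
  assumes "poly q 0 \<noteq> 0" and "\<And>t. poly q t \<noteq> 0 \<Longrightarrow> f t = poly p t / poly q t"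
  shows "regular_at_0 f"
  using assms unfolding regular_at_0_def by blast

lemma regular_at_0_const [simp]: "regular_at_0 (\<lambda>t. c)"
  by (rule regular_at_0I[of 1 _ "[:c:]"]) auto

lemma regular_at_0_ident [simp]: "regular_at_0 (\<lambda>t. t)"
  by (rule regular_at_0I[of 1 _ "[:0, 1:]"]) auto

lemma regular_at_0_add:
  assumes "regular_at_0 f" and "regular_at_0 g"
  shows "regular_at_0 (\<lambda>t. f t + g t)"
proof -
  obtain p q where f: "poly q 0 \<noteq> 0" "\<And>t. poly q t \<noteq> 0 \<Longrightarrow> f t = poly p t / poly q t"
    using assms(1) unfolding regular_at_0_def by blast
  obtain p' q' where g: "poly q' 0 \<noteq> 0" "\<And>t. poly q' t \<noteq> 0 \<Longrightarrow> g t = poly p' t / poly q' t"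
    using assms(2) unfolding regular_at_0_def by blast
  show ?thesis
    using f g by (intro regular_at_0I[of "q * q'" _ "p * q' + p' * q"]) (auto simp: field_simps)
qed

lemma regular_at_0_mult:
  assumes "regular_at_0 f" and "regular_at_0 g"
  shows "regular_at_0 (\<lambda>t. f t * g t)"
proof -
  obtain p q where f: "poly q 0 \<noteq> 0" "\<And>t. poly q t \<noteq> 0 \<Longrightarrow> f t = poly p t / poly q t"
    using assms(1) unfolding regular_at_0_def by blast
  obtain p' q' where g: "poly q' 0 \<noteq> 0" "\<And>t. poly q' t \<noteq> 0 \<Longrightarrow> g t = poly p' t / poly q' t"
    using assms(2) unfolding regular_at_0_def by blast
  show ?thesis
    using f(1) g(1) by (intro regular_at_0I[of "q * q'" _ "p * p'"]) (auto simp: f(2) g(2))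
qed

lemma regular_at_0_inverse:
  assumes "regular_at_0 f" and "f 0 \<noteq> 0"
  shows "regular_at_0 (\<lambda>t. inverse (f t))"
proof -
  obtain p q where f: "poly q 0 \<noteq> 0" "\<And>t. poly q t \<noteq> 0 \<Longrightarrow> f t = poly p t / poly q t"
    using assms(1) unfolding regular_at_0_def by blast
  have "poly p 0 \<noteq> 0" using f(1) f(2)[of 0] assms(2) by auto
  \<comment> \<open>The second factor \<open>q\<close> keeps the roots of \<open>q\<close>, where
    nothing is known about \<open>f\<close>, among the roots of the new denominator.\<close>
  then show ?thesis
    using f(1) by (intro regular_at_0I[of "p * q" _ "q * q"]) (auto simp: f(2))
qed

lemma regular_at_0_diff:
  assumes "regular_at_0 f" and "regular_at_0 g"
  shows "regular_at_0 (\<lambda>t. f t - g t)"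
  using regular_at_0_add[OF assms(1) regular_at_0_mult[OF regular_at_0_const[of "-1"] assms(2)]]
  by simp

lemma regular_at_0_divide:
  assumes "regular_at_0 f" and "regular_at_0 g" and "g 0 \<noteq> 0"
  shows "regular_at_0 (\<lambda>t. f t / g t)"
  unfolding divide_inverse using assms by (intro regular_at_0_mult regular_at_0_inverse)

lemma regular_at_0_sum:
  assumes "\<And>i. i \<in> I \<Longrightarrow> regular_at_0 (f i)"
  shows "regular_at_0 (\<lambda>t. \<Sum>i\<in>I. f i t)"
  using assms by (induction I rule: infinite_finite_induct) (auto intro: regular_at_0_add)

lemma regular_at_0_prod:
  assumes "\<And>i. i \<in> I \<Longrightarrow> regular_at_0 (f i)"
  shows "regular_at_0 (\<lambda>t. \<Prod>i\<in>I. f i t)"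
  using assms by (induction I rule: infinite_finite_induct) (auto intro: regular_at_0_mult)

lemma regular_at_0_power: "regular_at_0 f \<Longrightarrow> regular_at_0 (\<lambda>t. f t ^ k)"
  by (induction k) (auto intro: regular_at_0_mult)

lemma regular_at_0_det:
  fixes A :: "'a::field \<Rightarrow> 'a^'k^'k"
  assumes "\<And>i j. regular_at_0 (\<lambda>t. A t $ i $ j)"
  shows "regular_at_0 (\<lambda>t. det (A t))"
  unfolding det_def
  by (intro regular_at_0_sum regular_at_0_mult regular_at_0_prod regular_at_0_const assms)

lemma regular_at_0_matrix_vector_mult:
  fixes A :: "'a::field^'n^'m"
  assumes "\<And>j. regular_at_0 (\<lambda>t. v t $ j)"
  shows "regular_at_0 (\<lambda>t. (A *v v t) $ i)"
  unfolding matrix_vector_mult_def vec_lambda_beta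
  by (intro regular_at_0_sum regular_at_0_mult regular_at_0_const assms)

text \<open>Continuity at 0 in algebraic form: otherwise neither \<open>p\<close> nor
  \<open>q\<close> is the zero polynomial, and their roots, with the finitely many nonzeros of
  \<open>f\<close>, would exhaust an infinite field.\<close>

lemma regular_at_0_vanish:
  fixes f :: "'a::field \<Rightarrow> 'a"
  assumes inf: "infinite (UNIV :: 'a set)" and "regular_at_0 f" and fin: "finite {t. f t \<noteq> 0}"
  shows "f 0 = 0"
proof (rule ccontr)
  assume f0: "f 0 \<noteq> 0"
  obtain p q where f: "poly q 0 \<noteq> 0" "\<And>t. poly q t \<noteq> 0 \<Longrightarrow> f t = poly p t / poly q t"
    using assms(2) unfolding regular_at_0_def by blast
  have "p \<noteq> 0" "q \<noteq> 0" using f(1) f(2)[of 0] f0 by auto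
  then have "finite ({t. poly p t = 0} \<union> {t. poly q t = 0} \<union> {t. f t \<noteq> 0})"
    using fin by (simp add: poly_roots_finite)
  moreover have "{t. poly p t = 0} \<union> {t. poly q t = 0} \<union> {t. f t \<noteq> 0} = UNIV"
    using f(2) by force
  ultimately show False using inf by simp
qed

section \<open>Determinants of matrices with polynomial entries\<close>

lemma regular_at_0_coeff_det:
  fixes A :: "'a::field \<Rightarrow> 'a poly^'k^'k"
  assumes "\<And>i j k. regular_at_0 (\<lambda>t. coeff (A t $ i $ j) k)"
  shows "regular_at_0 (\<lambda>t. coeff (det (A t)) k)"
proof -
  have mult: "\<forall>k. regular_at_0 (\<lambda>t. coeff (p t * q t) k)"
    if "\<forall>k. regular_at_0 (\<lambda>t. coeff (p t) k)" "\<forall>k. regular_at_0 (\<lambda>t. coeff (q t) k)"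
    for p q :: "'a \<Rightarrow> 'a poly"
    unfolding coeff_mult using that by (intro allI regular_at_0_sum regular_at_0_mult) auto
  have prod: "\<forall>k. regular_at_0 (\<lambda>t. coeff (\<Prod>i\<in>I. p i t) k)"
    if "finite I" "\<And>i. \<forall>k. regular_at_0 (\<lambda>t. coeff (p i t) k)" for I :: "'k set" and p :: "'k \<Rightarrow> 'a \<Rightarrow> 'a poly"
    using that by (induction I rule: finite_induct) (auto intro: mult[rule_format])
  \<comment> \<open>The indeterminate of the entries is independent of the parameter
    \<open>t\<close>: by the Leibniz formula each coefficient of the determinant is polynomial in
    the coefficients of the entries.\<close>
  show ?thesis
    unfolding det_def coeff_sum
    by (intro regular_at_0_sum mult[rule_format] prod[rule_format]) (use assms in auto)
qed

lemma poly_det: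
  fixes A :: "'a::comm_ring_1 poly^'k^'k"
  shows "poly (det A) t = det (\<chi> i j. poly (A $ i $ j) t)"
  by (simp add: det_def poly_sum poly_prod)

text \<open>The bound goes row by row, since each Leibniz term uses one entry of every row. Constant
  rows cost nothing, which \<open>rank_pencil_le\<close> relies on.\<close>

lemma degree_det_le:
  fixes A :: "'a::idom poly^'k^'k"
  assumes "\<And>i j. degree (A $ i $ j) \<le> n i"
  shows "degree (det A) \<le> (\<Sum>i\<in>UNIV. n i)"
  unfolding det_def
proof (rule degree_sum_le)
  fix p :: "'k \<Rightarrow> 'k"
  have "degree (\<Prod>i\<in>UNIV. A $ i $ p i) \<le> (\<Sum>i\<in>UNIV. degree (A $ i $ p i))"
    using degree_prod_sum_le[of UNIV "\<lambda>i. A $ i $ p i"] by (simp add: o_def)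
  also have "\<dots> \<le> (\<Sum>i\<in>UNIV. n i)" by (intro sum_mono assms)
  finally show "degree (of_int (sign p) * (\<Prod>i\<in>UNIV. A $ i $ p i)) \<le> (\<Sum>i\<in>UNIV. n i)"
    using degree_mult_le[of "of_int (sign p)" "\<Prod>i\<in>UNIV. A $ i $ p i"] by simp
qed simp

text \<open>The tangent directions of the curves fill the space, so the lowest-order homogeneous part
  of the determinant at \<open>X0\<close> would vanish identically.\<close>

lemma det_vanish_of_curves:
  fixes e :: "'m \<Rightarrow> 'a::field^'m" and B :: "'m \<Rightarrow> 'a^'n^'m"
  assumes inf: "infinite (UNIV :: 'a set)"
    and curves: "\<And>x. \<exists>v. v 0 = x \<and> (\<forall>j. regular_at_0 (\<lambda>t. v t $ j))
      \<and> finite {t. det (\<chi> i. e i + B i *v (X0 + t *s v t)) \<noteq> 0}"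
  shows "det (\<chi> i. e i + B i *v x) = 0"
proof (rule ccontr)
  assume x: "det (\<chi> i. e i + B i *v x) \<noteq> 0"
  \<comment> \<open>The coefficient of index i of \<open>P v\<close> is the homogeneous part of
    degree i of the determinant at \<open>X0\<close>, evaluated at the displacement
    \<open>v\<close>.\<close>
  define P where "P v = det (\<chi> i j. [:(e i + B i *v X0) $ j, (B i *v v) $ j:])" for v
  have poly_P: "poly (P v) t = det (\<chi> i. e i + B i *v (X0 + t *s v))" for v t
  proof -
    have *: "(\<chi> i j. (e i + B i *v X0) $ j + t * (B i *v v) $ j) = (\<chi> i. e i + B i *v (X0 + t *s v))"
      by (simp add: vec_eq_iff matrix_vector_right_distrib vec.scale)
    show ?thesis unfolding P_def poly_det by (simp flip: *)
  qed
  have "poly (P (x - X0)) 1 \<noteq> 0" using x by (simp add: poly_P)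
  then have "P (x - X0) \<noteq> 0" by auto
  then have ex: "\<exists>k v. coeff (P v) k \<noteq> 0" using leading_coeff_0_iff by blast
  define k where "k = (LEAST k. \<exists>v. coeff (P v) k \<noteq> 0)"
  obtain y where y: "coeff (P y) k \<noteq> 0" using LeastI_ex[OF ex] unfolding k_def by blast
  have below: "coeff (P v) i = 0" if "i < k" for v i
    using not_less_Least[of i] that unfolding k_def by blast
  obtain v where v: "v 0 = y" "\<And>j. regular_at_0 (\<lambda>t. v t $ j)"
    "finite {t. det (\<chi> i. e i + B i *v (X0 + t *s v t)) \<noteq> 0}"
    using curves by blast
  let ?D = "CARD('m)"
  \<comment> \<open>Along the curve the displacement itself depends on \<open>t\<close>. The terms
    below \<open>k\<close> vanish, and \<open>h\<close> is what remains after dividing by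
    \<open>t ^ k\<close>; its value at 0 is the lowest part at \<open>y\<close>, which is
    nonzero.\<close>
  define h where "h t = (\<Sum>i=k..?D. coeff (P (v t)) i * t ^ (i - k))" for t
  have deg: "degree (P w) \<le> ?D" for w
    unfolding P_def by (rule order_trans[OF degree_det_le[where n = "\<lambda>_. 1"]]) auto
  have kD: "k \<le> ?D" using y deg le_degree order_trans by blast
  have eq: "poly (P (v t)) t = t ^ k * h t" for t
  proof -
    have "poly (P (v t)) t = (\<Sum>i\<le>?D. coeff (P (v t)) i * t ^ i)"
      unfolding poly_altdef using deg
      by (intro sum.mono_neutral_left) (auto simp: coeff_eq_0 not_le)
    also have "\<dots> = (\<Sum>i=k..?D. coeff (P (v t)) i * t ^ i)"
      by (rule sum.mono_neutral_right) (auto simp: below not_le)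
    also have "\<dots> = t ^ k * h t"
      unfolding h_def sum_distrib_left
      by (intro sum.cong refl) (simp add: mult_ac flip: power_add)
    finally show ?thesis .
  qed
  have "regular_at_0 h"
    unfolding h_def
  proof (intro regular_at_0_sum regular_at_0_mult regular_at_0_power regular_at_0_ident)
    have "regular_at_0 (\<lambda>t. coeff [:c, (B i *v v t) $ j:] l)" for c i j l
      using regular_at_0_matrix_vector_mult[of v "B i" j] v(2)
      by (cases l; cases "l - 1") auto
    then show "regular_at_0 (\<lambda>t. coeff (P (v t)) i)" for i
      unfolding P_def by (intro regular_at_0_coeff_det) simp
  qed
  moreover have "finite {t. h t \<noteq> 0}"
  proof (rule finite_subset)
    show "{t. h t \<noteq> 0} \<subseteq> insert 0 {t. det (\<chi> i. e i + B i *v (X0 + t *s v t)) \<noteq> 0}"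
      using eq by (auto simp: poly_P)
  qed (use v(3) in simp)
  ultimately have "h 0 = 0" using regular_at_0_vanish[OF inf] by blast
  moreover have "h 0 = coeff (P y) k"
  proof -
    have "h 0 = (\<Sum>i=k..?D. if i = k then coeff (P y) k else 0)"
      unfolding h_def v(1) by (intro sum.cong refl) auto
    then show ?thesis using kD by simp
  qed
  ultimately show False using y by simp
qed

subsection \<open>Kernels along a pencil\<close>

definition eval_space :: "('a::field^'n^'m) set \<Rightarrow> 'a^'n \<Rightarrow> ('a^'m) set" where
  "eval_space S x = (\<lambda>A. A *v x) ` S"

lemma mat_smult_mult_vec: "mat_smult c A *v x = c *s (A *v x)"
  by (simp add: mat_smult_def vec_eq_iff matrix_vector_mult_def sum_distrib_left mult_ac)

lemma mat_smult_zero [simp]: "mat_smult c 0 = 0"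
  by (simp add: mat_smult_def vec_eq_iff)

lemma subspace_eval_space:
  assumes "matrix_subspace S"
  shows "vec.subspace (eval_space S x)"
  unfolding vec.subspace_def
proof (intro conjI ballI allI)
  show "0 \<in> eval_space S x"
    using assms by (force simp: matrix_subspace_def eval_space_def)
next
  fix a b assume "a \<in> eval_space S x" "b \<in> eval_space S x"
  then show "a + b \<in> eval_space S x"
    using assms unfolding matrix_subspace_def eval_space_def
    by (auto simp flip: matrix_vector_mult_add_rdistrib)
next
  fix c a assume "a \<in> eval_space S x"
  then show "c *s a \<in> eval_space S x"
    using assms unfolding matrix_subspace_def eval_space_def
    by (auto simp flip: mat_smult_mult_vec)
qed

lemma subspace_preimage:
  fixes M :: "'a::field^'n^'m"
  assumes "vec.subspace W"
  shows "vec.subspace {u. M *v u \<in> W}"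
  using assms by (auto simp: vec.subspace_def matrix_vector_right_distrib vec.scale)

lemma subspace_kernel:
  fixes M :: "'a::field^'n^'m"
  shows "vec.subspace {u. M *v u = 0}"
  by (rule vec.subspace_kernel)

text \<open>With \<open>Q = 1 + tGN\<close>, the identity \<open>MQv = Mv - MGMv\<close> on the kernel of \<open>M + tN\<close> shows
  that \<open>Q\<close> maps this kernel into that of \<open>M\<close>; the dimensions make this map bijective.\<close>

lemma
  fixes M N :: "'a::field^'n^'m"
  assumes rk: "rank (M + mat_smult t N) \<le> rank M" and G: "M ** G ** M = M"
    and det: "det (mat 1 + mat_smult t (G ** N)) \<noteq> 0"
  shows rank_pencil_eq: "rank (M + mat_smult t N) = rank M"
    and kernel_pencil: "M *v ((mat 1 + mat_smult t (G ** N)) *v w) = 0 \<Longrightarrow> (M + mat_smult t N) *v w = 0"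
proof -
  let ?Q = "mat 1 + mat_smult t (G ** N)"
  let ?K = "{v. (M + mat_smult t N) *v v = 0}" and ?L = "{v. M *v v = 0}"
  have inj: "inj ((*v) ?Q)"
    using det by (simp add: invertible_det_nz[symmetric] invertible_left_inverse matrix_left_invertible_injective)
  have GM: "M *v (G *v (M *v v)) = M *v v" for v
    by (metis G matrix_vector_mul_assoc)
  have sub: "(*v) ?Q ` ?K \<subseteq> ?L"
  proof (rule image_subsetI)
    fix v assume "v \<in> ?K"
    then have v: "t *s (N *v v) = - (M *v v)"
      by (simp only: mem_Collect_eq matrix_vector_mult_add_rdistrib mat_smult_mult_vec add_eq_0_iff)
    have "M *v (?Q *v v) = M *v v + M *v (G *v (t *s (N *v v)))"
      by (simp add: matrix_vector_mult_add_rdistrib mat_smult_mult_vec vec.scale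
          matrix_vector_right_distrib matrix_vector_mul_assoc matrix_mul_assoc)
    also have "\<dots> = 0" unfolding v by (simp add: vec.neg GM)
    finally show "?Q *v v \<in> ?L" by simp
  qed
  have dimK: "vec.dim ((*v) ?Q ` ?K) = vec.dim ?K"
    by (rule vec.dim_image_eq) (use inj in \<open>auto intro: inj_on_subset\<close>)
  have "vec.dim ?L \<le> vec.dim ?K"
    using dim_kernel_plus_rank[of M] dim_kernel_plus_rank[of "M + mat_smult t N"] rk by simp
  then have eq: "(*v) ?Q ` ?K = ?L"
    using sub dimK by (intro vec.subspace_dim_equal vec.subspace_image subspace_kernel) auto
  then show "rank (M + mat_smult t N) = rank M"
    using dimK dim_kernel_plus_rank[of M] dim_kernel_plus_rank[of "M + mat_smult t N"] by simp
  show "(M + mat_smult t N) *v w = 0" if "M *v (?Q *v w) = 0"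
  proof -
    have "?Q *v w \<in> (*v) ?Q ` ?K" using that unfolding eq by simp
    then show ?thesis using inj by (auto dest: injD)
  qed
qed

text \<open>Cramer's rule solves \<open>Q t *v w = z + t *s y\<close> rationally in
  \<open>t\<close>. The right side lies in the kernel of \<open>M\<close>, so
  \<open>kernel_pencil\<close> puts \<open>w t\<close> in the kernel of the pencil. The free kernel
  vector \<open>y\<close> serves to adjust the velocity at 0, which is
  \<open>y - G *v (N *v z)\<close>.\<close>

lemma kernel_curve:
  fixes M N :: "'a::field^'n^'m"
  assumes inf: "infinite (UNIV :: 'a set)"
    and rk: "\<And>t. rank (M + mat_smult t N) \<le> rank M" and G: "M ** G ** M = M"
    and z: "M *v z = 0" and y: "M *v y = 0"
  obtains w where "w 0 = z" and "\<And>j. regular_at_0 (\<lambda>t. w t $ j)"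
    and "finite {t. \<not> (rank (M + mat_smult t N) = rank M \<and> (M + mat_smult t N) *v w t = 0
        \<and> w t = z + t *s (y - G *v (N *v w t)))}"
proof -
  define Q where "Q t = mat 1 + mat_smult t (G ** N)" for t
  define w where "w t = (\<chi> k. det (\<chi> i j. if j = k then (z + t *s y) $ i else Q t $ i $ j) / det (Q t))" for t
  define p where "p = det (\<chi> i j. [:(mat 1 :: 'a^'n^'n) $ i $ j, (G ** N) $ i $ j:])"
  have Q0: "Q 0 = mat 1" by (simp add: Q_def mat_smult_def vec_eq_iff)
  have regQ: "regular_at_0 (\<lambda>t. Q t $ i $ j)" for i j
    by (auto simp: Q_def mat_smult_def intro!: regular_at_0_add regular_at_0_mult)
  have p: "poly p t = det (Q t)" for t
    by (simp add: p_def poly_det Q_def mat_smult_def plus_vec_def)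
  have Qw: "Q t *v w t = z + t *s y" if "det (Q t) \<noteq> 0" for t
    using cramer[OF that, of "w t" "z + t *s y"] unfolding w_def by simp
  have "p \<noteq> 0" using p[of 0] by (auto simp: Q0)
  then have fin: "finite {t. det (Q t) = 0}"
    using poly_roots_finite[of p] by (simp add: p)
  show ?thesis
  proof (rule that)
    show "w 0 = z" using Qw[of 0] by (simp add: Q0)
    show "regular_at_0 (\<lambda>t. w t $ j)" for j
    proof -
      have "regular_at_0 (\<lambda>t. (z + t *s y) $ i)" for i
        by (auto intro!: regular_at_0_add regular_at_0_mult)
      then have "regular_at_0 (\<lambda>t. if l = j then (z + t *s y) $ i else Q t $ i $ l)" for i l
        using regQ by (cases "l = j") simp_all
      then show ?thesis
        unfolding w_def vec_lambda_beta
        by (intro regular_at_0_divide regular_at_0_det) (simp_all add: Q0 regQ)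
    qed
    show "finite {t. \<not> (rank (M + mat_smult t N) = rank M \<and> (M + mat_smult t N) *v w t = 0
        \<and> w t = z + t *s (y - G *v (N *v w t)))}"
    proof (rule finite_subset[OF _ fin], safe)
      fix t assume not0: "det (Q t) \<noteq> 0"
      show "rank (M + mat_smult t N) = rank M"
        using rank_pencil_eq[OF rk G] not0 unfolding Q_def by blast
      have "M *v (Q t *v w t) = 0"
        by (simp add: Qw[OF not0] matrix_vector_right_distrib vec.scale z y)
      then show "(M + mat_smult t N) *v w t = 0"
        using kernel_pencil[OF rk G] not0 unfolding Q_def by blast
      show "w t = z + t *s (y - G *v (N *v w t))"
        using Qw[OF not0] unfolding Q_def
        by (simp add: matrix_vector_mult_add_rdistrib mat_smult_mult_vec algebra_simps
            matrix_vector_mul_assoc vec.scale_right_diff_distrib)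
    qed
  qed
qed

text \<open>On the curve of \<open>kernel_curve\<close> with \<open>y = 0\<close>,
  \<open>N *v w t\<close> is a multiple of \<open>M *v w t\<close> for almost all nonzero
  \<open>t\<close>, hence lies in the image of \<open>M\<close>. Written as
  \<open>?D *v w t = 0\<close>, this passes to \<open>t = 0\<close>, where the curve is at
  \<open>z\<close>.\<close>

lemma eval_space_subset_range:
  fixes S :: "('a::field^'n^'m) set"
  assumes inf: "infinite (UNIV :: 'a set)" and S: "matrix_subspace S"
    and rk: "\<And>A. A \<in> S \<Longrightarrow> rank A \<le> rank M" and M: "M \<in> S" and z: "M *v z = 0"
  shows "eval_space S z \<subseteq> range ((*v) M)"
proof
  fix a assume "a \<in> eval_space S z"
  then obtain N where N: "N \<in> S" "a = N *v z" by (auto simp: eval_space_def)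
  obtain G where G: "M ** G ** M = M" using exists_generalized_inverse by blast
  have rk': "rank (M + mat_smult t N) \<le> rank M" for t
    using rk S M N by (auto simp: matrix_subspace_def)
  obtain w where w: "w 0 = z" "\<And>j. regular_at_0 (\<lambda>t. w t $ j)"
    "finite {t. \<not> (rank (M + mat_smult t N) = rank M \<and> (M + mat_smult t N) *v w t = 0
        \<and> w t = z + t *s (0 - G *v (N *v w t)))}" (is "finite ?F")
    using kernel_curve[OF inf rk' G z, of 0] by auto
  let ?D = "N - M ** G ** N"
  have "(?D *v w t) = 0" if "t \<noteq> 0" "t \<notin> ?F" for t
  proof -
    have "(M + mat_smult t N) *v w t = 0" using that(2) by blast
    then have v: "t *s (N *v w t) = - (M *v w t)"
      by (simp add: matrix_vector_mult_add_rdistrib mat_smult_mult_vec add_eq_0_iff)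
    have "t *s (?D *v w t) = t *s (N *v w t) - M *v (G *v (t *s (N *v w t)))"
      by (simp add: matrix_vector_mult_diff_rdistrib vec.scale_right_diff_distrib
          vec.scale matrix_vector_mul_assoc matrix_mul_assoc)
    also have "\<dots> = 0"
      unfolding v by (simp add: vec.neg) (metis G matrix_vector_mul_assoc)
    finally show ?thesis using that(1) by simp
  qed
  then have "{t. (?D *v w t) $ i \<noteq> 0} \<subseteq> insert 0 ?F" for i by force
  then have "finite {t. (?D *v w t) $ i \<noteq> 0}" for i
    using w(3) finite_subset by blast
  then have "(?D *v w 0) $ i = 0" for i
    by (intro regular_at_0_vanish[OF inf] regular_at_0_matrix_vector_mult w(2)) simp
  then have "?D *v z = 0" by (simp add: vec_eq_iff w(1))
  then have "N *v z = M *v (G *v (N *v z))"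
    by (simp add: matrix_vector_mult_diff_rdistrib flip: matrix_vector_mul_assoc)
  then show "a \<in> range ((*v) M)" using N(2) by (metis rangeI)
qed

text \<open>Differentiating (M + tN) w = 0 at 0 gives M w'(0) = - N z, which suggests an
  \<open>N\<close> with \<open>N *v z = - (M *v u)\<close>. Apart from finitely many
  \<open>t\<close>, \<open>z + t *s v t\<close> is the kernel curve for this
  \<open>N\<close>.\<close>

lemma tangent_curve:
  fixes S :: "('a::field^'n^'m) set"
  assumes inf: "infinite (UNIV :: 'a set)" and S: "matrix_subspace S"
    and rk: "\<And>A. A \<in> S \<Longrightarrow> rank A \<le> rank M" and M: "M \<in> S" and z: "M *v z = 0"
    and u: "M *v u \<in> eval_space S z"
  shows "\<exists>v. v 0 = u \<and> (\<forall>j. regular_at_0 (\<lambda>t. v t $ j))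
    \<and> finite {t. \<not> (\<exists>A\<in>S. rank A = rank M \<and> A *v (z + t *s v t) = 0)}"
proof -
  obtain N0 where N0: "N0 \<in> S" "M *v u = N0 *v z" using u by (auto simp: eval_space_def)
  define N where "N = mat_smult (-1) N0"
  have N: "N \<in> S" using S N0(1) by (auto simp: matrix_subspace_def N_def)
  have Nz: "N *v z = - (M *v u)" by (simp add: N_def mat_smult_mult_vec N0(2))
  obtain G where G: "M ** G ** M = M" using exists_generalized_inverse by blast
  have MtN: "M + mat_smult t N \<in> S" for t
    using S M N by (auto simp: matrix_subspace_def)
  \<comment> \<open>The kernel curve has velocity \<open>y - G *v (N *v z)\<close> at 0; this
    \<open>y\<close> makes it \<open>u\<close>, and \<open>M *v y = 0\<close> because
    \<open>M ** G\<close> fixes \<open>M *v u\<close>.\<close>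
  define y where "y = u + G *v (N *v z)"
  have "M *v y = 0"
  proof -
    have "M *v (G *v (M *v u)) = M *v u" by (metis G matrix_vector_mul_assoc)
    then show ?thesis by (simp add: y_def Nz vec.neg vec.diff)
  qed
  then obtain w where w: "w 0 = z" "\<And>j. regular_at_0 (\<lambda>t. w t $ j)"
    "finite {t. \<not> (rank (M + mat_smult t N) = rank M \<and> (M + mat_smult t N) *v w t = 0
        \<and> w t = z + t *s (y - G *v (N *v w t)))}" (is "finite ?F")
    using kernel_curve[OF inf rk[OF MtN] G z] by blast
  define v where "v t = y - G *v (N *v w t)" for t
  have "v 0 = u" by (simp add: v_def y_def w(1))
  moreover have "regular_at_0 (\<lambda>t. v t $ j)" for j
    unfolding v_def vector_minus_component
    by (intro regular_at_0_diff regular_at_0_const regular_at_0_matrix_vector_mult w(2))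
  moreover have "{t. \<not> (\<exists>A\<in>S. rank A = rank M \<and> A *v (z + t *s v t) = 0)} \<subseteq> ?F"
  proof (rule subsetI, rule ccontr)
    fix t assume "t \<notin> ?F"
    then have "rank (M + mat_smult t N) = rank M" "(M + mat_smult t N) *v (z + t *s v t) = 0"
      unfolding v_def by auto
    moreover assume "t \<in> {t. \<not> (\<exists>A\<in>S. rank A = rank M \<and> A *v (z + t *s v t) = 0)}"
    ultimately show False using MtN by blast
  qed
  ultimately show ?thesis using w(3) finite_subset by blast
qed

text \<open>Greedy choice: as long as \<open>W\<close> is proper, some \<open>T i\<close> is not
  contained in it, and adding it raises the dimension, so the codimension of \<open>W\<close> bounds
  the number of steps.\<close>

lemma exists_small_spanning_subfamily:
  fixes T :: "'i \<Rightarrow> ('a::field^'n) set"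
  assumes "vec.span (\<Union>i\<in>P. T i) = UNIV" and "vec.subspace W"
  shows "\<exists>F\<subseteq>P. finite F \<and> card F \<le> CARD('n) - vec.dim W \<and> vec.span (W \<union> (\<Union>i\<in>F. T i)) = UNIV"
  using assms(2)
proof (induction "CARD('n) - vec.dim W" arbitrary: W rule: less_induct)
  case less
  show ?case
  proof (cases "W = UNIV")
    case True
    then show ?thesis by (intro exI[of _ "{}"]) auto
  next
    case False
    then obtain i where i: "i \<in> P" "\<not> T i \<subseteq> W"
      using assms(1) vec.span_minimal[of "\<Union>i\<in>P. T i" W] less.prems by blast
    define W' where "W' = vec.span (W \<union> T i)"
    have W': "vec.subspace W'" "W \<subset> W'"
      using i(2) vec.span_superset[of "W \<union> T i"] unfolding W'_def by auto
    have "\<not> vec.dim W' \<le> vec.dim W"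
      using vec.subspace_dim_equal[of W W'] W' less.prems by blast
    moreover have le: "vec.dim W' \<le> CARD('n)" by (rule dim_subset_UNIV_cart_gen)
    ultimately have lt: "CARD('n) - vec.dim W' < CARD('n) - vec.dim W" by linarith
    obtain F where F: "F \<subseteq> P" "finite F" "card F \<le> CARD('n) - vec.dim W'"
      "vec.span (W' \<union> (\<Union>i\<in>F. T i)) = UNIV"
      using less.hyps[OF lt W'(1)] by blast
    have "W' \<subseteq> vec.span (W \<union> (\<Union>i\<in>insert i F. T i))"
      unfolding W'_def by (intro vec.span_mono) auto
    moreover have "(\<Union>i\<in>F. T i) \<subseteq> vec.span (W \<union> (\<Union>i\<in>insert i F. T i))"
      using vec.span_superset[of "W \<union> (\<Union>i\<in>insert i F. T i)"] by blast
    ultimately have "vec.span (W' \<union> (\<Union>i\<in>F. T i)) \<subseteq> vec.span (W \<union> (\<Union>i\<in>insert i F. T i))"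
      by (intro vec.span_minimal) auto
    moreover have "card (insert i F) \<le> CARD('n) - vec.dim W"
      using F(2,3) lt card_insert_le_m1[of "CARD('n) - vec.dim W" F i] by linarith
    ultimately show ?thesis
      using F i(1) by (intro exI[of _ "insert i F"]) auto
  qed
qed

lemma span_Union_subspaces:
  fixes T :: "'i \<Rightarrow> ('a::field^'n) set"
  assumes "finite I" and T: "\<And>i. i \<in> I \<Longrightarrow> vec.subspace (T i)"
    and "x \<in> vec.span (\<Union>i\<in>I. T i)"
  shows "\<exists>u. (\<forall>i\<in>I. u i \<in> T i) \<and> x = (\<Sum>i\<in>I. u i)"
  using assms(3)
proof (induction rule: vec.span_induct_alt)
  case base
  show ?case using T by (intro exI[of _ "\<lambda>_. 0"]) (auto simp: vec.subspace_0)
next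
  case (step c a b)
  then obtain u k where u: "\<forall>i\<in>I. u i \<in> T i" "b = (\<Sum>i\<in>I. u i)" and k: "k \<in> I" "a \<in> T k"
    by blast
  have "c *s a + b = (\<Sum>i\<in>I. (if i = k then c *s a else 0) + u i)"
    using k(1) assms(1) by (simp add: sum.distrib u(2))
  moreover have "\<forall>i\<in>I. (if i = k then c *s a else 0) + u i \<in> T i"
    using u(1) k T by (auto intro: vec.subspace_add vec.subspace_scale)
  ultimately show ?case by (intro exI[of _ "\<lambda>i. (if i = k then c *s a else 0) + u i"]) auto
qed

subsection \<open>The bound over an infinite field\<close>

lemma eval_space_sum_subset:
  "eval_space S (\<Sum>i\<in>I. w i) \<subseteq> vec.span (\<Union>i\<in>I. eval_space S (w i))"
proof
  fix a assume "a \<in> eval_space S (\<Sum>i\<in>I. w i)"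
  then obtain A where "A \<in> S" "a = (\<Sum>i\<in>I. A *v w i)"
    by (auto simp: eval_space_def vec.sum)
  moreover have "A *v w i \<in> (\<Union>i\<in>I. eval_space S (w i))" if "A \<in> S" "i \<in> I" for A i
    using that by (auto simp: eval_space_def)
  ultimately show "a \<in> vec.span (\<Union>i\<in>I. eval_space S (w i))"
    by (auto intro!: vec.span_sum intro: vec.span_base)
qed

text \<open>If \<open>dim Sx\<close> exceeds the bound, then some matrix whose rows are vectors \<open>Ax\<close> with \<open>A\<close>
  in \<open>S\<close>, completed by constant rows, is invertible at \<open>x\<close> and singular along the curves.\<close>

lemma dim_eval_space_le_of_curves:
  fixes S :: "('a::field^'n^'m) set"
  assumes inf: "infinite (UNIV :: 'a set)" and S: "matrix_subspace S"
    and curves: "\<And>x. \<exists>v. v 0 = x \<and> (\<forall>j. regular_at_0 (\<lambda>t. v t $ j))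
      \<and> finite {t. \<not> vec.dim (eval_space S (X0 + t *s v t)) \<le> \<rho>}"
  shows "vec.dim (eval_space S x) \<le> \<rho>"
proof (rule ccontr)
  assume gt: "\<not> vec.dim (eval_space S x) \<le> \<rho>"
  obtain E where E: "E \<subseteq> eval_space S x" "vec.independent E" "card E = vec.dim (eval_space S x)"
    by (rule vec.basis_exists[of "eval_space S x"]) blast
  obtain e :: "'m \<Rightarrow> 'a^'m" where e: "inj e" "E \<subseteq> range e" "det (\<chi> i. e i) \<noteq> 0"
    using exists_basis_matrix[OF E(2)] by (elim exE conjE)
  define I where "I = {i. e i \<in> E}"
  have "\<exists>A. A \<in> S \<and> A *v x = b" if "b \<in> E" for b
    using E(1) that by (force simp: eval_space_def)
  then obtain A where A: "\<And>b. b \<in> E \<Longrightarrow> A b \<in> S \<and> A b *v x = b" by metis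
  define B where "B i = (if i \<in> I then A (e i) else 0)" for i
  define c where "c i = (if i \<in> I then 0 else e i)" for i
  have "e ` I = E" using e(2) unfolding I_def by blast
  then have cardI: "card I = card E"
    using card_image[of e I] inj_on_subset[OF e(1) subset_UNIV] by simp
  have "c i + B i *v x = e i" for i
    using A by (auto simp: c_def B_def I_def)
  then have "det (\<chi> i. c i + B i *v x) \<noteq> 0" using e(3) by simp
  moreover have sing: "det (\<chi> i. c i + B i *v X) = 0" if "vec.dim (eval_space S X) \<le> \<rho>" for X
  proof (rule det_rows_eq_0)
    show "c i + B i *v X \<in> eval_space S X" if "i \<in> I" for i
      using that A by (auto simp: c_def B_def I_def eval_space_def)
    show "vec.dim (eval_space S X) < card I" using that gt E(3) cardI by linarith
  qed
  moreover have "det (\<chi> i. c i + B i *v x) = 0"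
  proof (rule det_vanish_of_curves[OF inf])
    fix y
    obtain v where v: "v 0 = y" "\<forall>j. regular_at_0 (\<lambda>t. v t $ j)"
      "finite {t. \<not> vec.dim (eval_space S (X0 + t *s v t)) \<le> \<rho>}"
      using curves by blast
    have "{t. det (\<chi> i. c i + B i *v (X0 + t *s v t)) \<noteq> 0} \<subseteq> {t. \<not> vec.dim (eval_space S (X0 + t *s v t)) \<le> \<rho>}"
      using sing by blast
    then show "\<exists>v. v 0 = y \<and> (\<forall>j. regular_at_0 (\<lambda>t. v t $ j))
        \<and> finite {t. det (\<chi> i. c i + B i *v (X0 + t *s v t)) \<noteq> 0}"
      using v finite_subset by blast
  qed
  ultimately show False by blast
qed

lemma dim_eval_space_le_infinite:
  fixes S :: "('a::field^'n^'m) set"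
  assumes inf: "infinite (UNIV :: 'a set)" and S: "matrix_subspace S"
    and rk: "\<And>A. A \<in> S \<Longrightarrow> rank A \<le> r"
    and ker: "vec.span {z. \<exists>A\<in>S. rank A = r \<and> A *v z = 0} = UNIV"
  shows "\<exists>d\<le>r. \<forall>x. vec.dim (eval_space S x) \<le> (r + 1 - d) * d"
proof -
  define P where "P = {(M, z). M \<in> S \<and> rank M = r \<and> M *v z = 0}"
  define T :: "('a^'n^'m) \<times> ('a^'n) \<Rightarrow> ('a^'n) set" where "T p = {u. fst p *v u \<in> eval_space S (snd p)}" for p
  have sub: "vec.subspace (T p)" for p
    unfolding T_def by (intro subspace_preimage subspace_eval_space S)
  have range: "eval_space S (snd p) \<subseteq> range ((*v) (fst p))" if "p \<in> P" for p
    using that rk by (intro eval_space_subset_range[OF inf S]) (auto simp: P_def)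
  have "P \<noteq> {}"
  proof
    assume "P = {}"
    then have empty: "{z. \<exists>A\<in>S. rank A = r \<and> A *v z = 0} = {}" by (auto simp: P_def)
    have "vec.dim (UNIV :: ('a^'n) set) = 0"
      unfolding ker[symmetric] empty by (simp del: vec.dim_UNIV vec.span_empty)
    then show False by (simp add: vec_dim_card del: vec.dim_UNIV)
  qed
  then obtain p0 where p0: "p0 \<in> P" by blast
  obtain p1 where p1: "p1 \<in> P" "\<And>p. p \<in> P \<Longrightarrow> vec.dim (eval_space S (snd p)) \<le> vec.dim (eval_space S (snd p1))"
  proof -
    have "\<forall>p. p \<in> P \<longrightarrow> vec.dim (eval_space S (snd p)) < Suc CARD('m)"
      using dim_subset_UNIV_cart_gen by (auto simp: less_Suc_eq_le)
    from ex_has_greatest_nat[of "\<lambda>p. p \<in> P", OF p0 this] show ?thesis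
      using that by blast
  qed
  define d where "d = vec.dim (eval_space S (snd p1))"
  have rank1: "rank (fst p1) = r" using p1(1) by (auto simp: P_def)
  have d: "d \<le> r"
    using vec.dim_subset[OF range[OF p1(1)]] unfolding d_def rank1[symmetric] rank_eq_dim_range .
  \<comment> \<open>Rank-nullity for \<open>fst p1\<close> on \<open>T p1\<close>: the kernel is the
    full kernel of the matrix, and the image is all of \<open>eval_space S (snd p1)\<close>, since
    that lies in its range.\<close>
  have dimT: "vec.dim (T p1) + r = CARD('n) + d"
  proof -
    have "{v \<in> T p1. fst p1 *v v = 0} = {v. fst p1 *v v = 0}"
      using vec.subspace_0[OF subspace_eval_space[OF S]] by (auto simp: T_def)
    moreover have "(*v) (fst p1) ` T p1 = eval_space S (snd p1)"
      using range[OF p1(1)] by (auto simp: T_def)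
    ultimately have "vec.dim {v. fst p1 *v v = 0} + d = vec.dim (T p1)"
      using vec_dim_kernel_image[OF matrix_vector_mul_linear_gen sub[of p1], of "fst p1"] d_def by simp
    then show ?thesis using dim_kernel_plus_rank[of "fst p1"] rank1 by simp
  qed
  have "{z. \<exists>A\<in>S. rank A = r \<and> A *v z = 0} \<subseteq> (\<Union>p\<in>P. T p)"
    using vec.subspace_0[OF subspace_eval_space[OF S]] by (force simp: P_def T_def)
  then have span: "vec.span (\<Union>p\<in>P. T p) = UNIV"
    using ker vec.span_mono[of "{z. \<exists>A\<in>S. rank A = r \<and> A *v z = 0}" "\<Union>p\<in>P. T p"]
    by (simp add: top_unique)
  obtain F where F: "F \<subseteq> P" "finite F" "card F \<le> CARD('n) - vec.dim (T p1)"
    "vec.span (T p1 \<union> (\<Union>p\<in>F. T p)) = UNIV"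
    using exists_small_spanning_subfamily[OF span sub[of p1]] by (elim exE conjE)
  define F1 where "F1 = insert p1 F"
  \<comment> \<open>\<open>T p1\<close> has codimension \<open>r - d\<close>; the additional 1
    counts \<open>p1\<close> itself.\<close>
  have F1: "F1 \<subseteq> P" "finite F1" "vec.span (\<Union>p\<in>F1. T p) = UNIV" "card F1 \<le> r + 1 - d"
    using F p1(1) dimT d card_insert_le_m1[of "r + 1 - d" F p1] by (auto simp: F1_def)
  have "vec.dim (eval_space S x) \<le> card F1 * d" for x
  proof (rule dim_eval_space_le_of_curves[OF inf S, of "\<Sum>p\<in>F1. snd p"])
    fix x
    \<comment> \<open>Since the tangent spaces fill the space, any velocity \<open>x\<close> is a
      sum of velocities \<open>u p\<close>, each realised by a curve of kernel vectors through
      \<open>snd p\<close>.\<close>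
    obtain u where u: "\<forall>p\<in>F1. u p \<in> T p" "x = (\<Sum>p\<in>F1. u p)"
      using span_Union_subspaces[OF F1(2), of T x] sub F1(3) by blast
    define good where "good p v \<longleftrightarrow> v 0 = u p \<and> (\<forall>j. regular_at_0 (\<lambda>t. v t $ j))
        \<and> finite {t. \<not> (\<exists>A\<in>S. rank A = r \<and> A *v (snd p + t *s v t) = 0)}" for p v
    have "\<exists>v. good p v" if "p \<in> F1" for p
    proof -
      have p: "fst p \<in> S" "rank (fst p) = r" "fst p *v snd p = 0"
        using that F1(1) by (auto simp: P_def)
      show ?thesis
        unfolding good_def p(2)[symmetric]
        by (rule tangent_curve[OF inf S _ p(1,3)]) (use rk u(1) that p(2) in \<open>simp_all add: T_def\<close>)
    qed
    then obtain v where "\<And>p. p \<in> F1 \<Longrightarrow> good p (v p)" by metis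
    then have v: "\<And>p. p \<in> F1 \<Longrightarrow> v p 0 = u p"
      "\<And>p j. p \<in> F1 \<Longrightarrow> regular_at_0 (\<lambda>t. v p t $ j)"
      "\<And>p. p \<in> F1 \<Longrightarrow> finite {t. \<not> (\<exists>A\<in>S. rank A = r \<and> A *v (snd p + t *s v p t) = 0)}"
      unfolding good_def by simp_all
    define w where "w t = (\<Sum>p\<in>F1. v p t)" for t
    have "w 0 = x" by (simp add: w_def u(2) v(1))
    moreover have "regular_at_0 (\<lambda>t. w t $ j)" for j
      unfolding w_def sum_component by (intro regular_at_0_sum v(2))
    moreover have "finite {t. \<not> vec.dim (eval_space S ((\<Sum>p\<in>F1. snd p) + t *s w t)) \<le> card F1 * d}"
    proof (rule finite_subset)
      show "finite (\<Union>p\<in>F1. {t. \<not> (\<exists>A\<in>S. rank A = r \<and> A *v (snd p + t *s v p t) = 0)})"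
        using F1(2) v(3) by blast
      show "{t. \<not> vec.dim (eval_space S ((\<Sum>p\<in>F1. snd p) + t *s w t)) \<le> card F1 * d}
        \<subseteq> (\<Union>p\<in>F1. {t. \<not> (\<exists>A\<in>S. rank A = r \<and> A *v (snd p + t *s v p t) = 0)})"
      proof (rule ccontr)
        assume "\<not> ?thesis"
        then obtain t where t: "\<not> vec.dim (eval_space S ((\<Sum>p\<in>F1. snd p) + t *s w t)) \<le> card F1 * d"
          "\<forall>p\<in>F1. \<exists>A\<in>S. rank A = r \<and> A *v (snd p + t *s v p t) = 0" by blast
        \<comment> \<open>For this \<open>t\<close> the point on each curve is again a kernel vector
          of a matrix of rank \<open>r\<close>, so the maximality of \<open>d\<close> applies to
          it.\<close>
        have le: "vec.dim (eval_space S (snd p + t *s v p t)) \<le> d" if p: "p \<in> F1" for p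
        proof -
          obtain A where "A \<in> S" "rank A = r" "A *v (snd p + t *s v p t) = 0" using t(2) p by blast
          then show ?thesis
            using p1(2)[of "(A, snd p + t *s v p t)"] by (simp add: P_def d_def)
        qed
        have sum: "(\<Sum>p\<in>F1. snd p) + t *s w t = (\<Sum>p\<in>F1. snd p + t *s v p t)"
          by (simp add: w_def sum.distrib vec.scale_sum_right)
        have "vec.dim (eval_space S ((\<Sum>p\<in>F1. snd p) + t *s w t)) \<le> card F1 * d"
          unfolding sum by (rule dim_Union_span_le[OF F1(2) le eval_space_sum_subset])
        then show False using t(1) by simp
      qed
    qed
    ultimately show "\<exists>v. v 0 = x \<and> (\<forall>j. regular_at_0 (\<lambda>t. v t $ j))
        \<and> finite {t. \<not> vec.dim (eval_space S ((\<Sum>p\<in>F1. snd p) + t *s v t)) \<le> card F1 * d}"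
      by (intro exI[of _ w]) simp
  qed
  moreover have "card F1 * d \<le> (r + 1 - d) * d" using F1(4) by (rule mult_le_mono1)
  ultimately show ?thesis using d order_trans by (intro exI[of _ d]) blast
qed

text \<open>The factors have sum r + 1, so their product is at most (r + 1)^2 / 4; the rest compares
  this with the binomial bound, in terms of \<open>q = r - 2\<close>.\<close>

lemma square_bound_le_binomial:
  fixes d r :: nat
  assumes "d \<le> r" and "r \<ge> 2"
  shows "(r + 1 - d) * d \<le> 6 + ((r - 2) choose 2)"
proof -
  obtain q where q: "r = q + 2" using assms(2) le_Suc_ex by (metis add.commute)
  have "4 * ((r + 1 - d) * d) \<le> (q + 3)\<^sup>2"
  proof -
    obtain a where a: "r = d + a" using assms(1) le_Suc_ex by blast
    have "4 * ((int a + 1) * int d) \<le> (int a + 1 + int d)\<^sup>2"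
      using zero_le_power2[of "int a + 1 - int d"] by (simp add: power2_eq_square algebra_simps)
    moreover have "int q + 3 = int a + 1 + int d" "r + 1 - d = a + 1" using a q by linarith+
    ultimately have "4 * ((int a + 1) * int d) \<le> (int q + 3)\<^sup>2" "r + 1 - d = a + 1" by metis+
    then show ?thesis
      by (simp add: algebra_simps flip: of_nat_le_iff[where ?'a = int])
  qed
  moreover have "even (q * (q - 1))" by (cases q) auto
  then have "2 * (q choose 2) = q * (q - 1)" by (simp add: choose_two)
  \<comment> \<open>The final 4 with the strict inequality is the gain from integrality: for
    \<open>q = 4\<close> the plain comparison would be 49 against 48. The two sides differ by (q -
    4)^2 + 3.\<close>
  moreover have "(q + 3)\<^sup>2 < 24 + 2 * (q * (q - 1)) + 4"
  proof (cases q)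
    case (Suc k)
    have "0 \<le> (int k - 3)\<^sup>2" by simp
    then show ?thesis using Suc
      by (simp add: power2_eq_square algebra_simps flip: of_nat_less_iff[where ?'a = int])
  qed (simp add: power2_eq_square)
  ultimately show ?thesis unfolding q by simp
qed

subsection \<open>Extension of scalars\<close>

text \<open>A determinant witnessing a larger rank at \<open>t0\<close> has, after a choice of basis adapted to the
  kernel of \<open>N\<close>, at most \<open>rank N\<close> rows that depend on \<open>t\<close>.\<close>

lemma rank_pencil_le:
  fixes R N :: "'a::field^'n^'m"
  assumes N: "rank N \<le> r" and T: "finite T \<Longrightarrow> r < card T"
    and rk: "\<And>t. t \<in> T \<Longrightarrow> rank (R + mat_smult t N) \<le> r"
  shows "rank (R + mat_smult t N) \<le> r"
proof (rule ccontr)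
  define M where "M = R + mat_smult t N"
  assume "\<not> rank (R + mat_smult t N) \<le> r"
  then have gt: "r < rank M" by (simp add: M_def)
  obtain g where g: "Vector_Spaces.linear (*s) (*s) g" "\<forall>y\<in>range ((*v) M). M *v (g y) = y"
    using vec.linear_exists_right_inverse_on[of "(*v) M" UNIV] by auto
  \<comment> \<open>\<open>V\<close> is a complement of the kernel of \<open>M\<close>, so
    \<open>M\<close> maps it bijectively onto its image.\<close>
  define V where "V = g ` range ((*v) M)"
  have V: "vec.subspace V"
    unfolding V_def by (intro vec.linear_subspace_image[OF g(1)] vec.subspace_image) simp
  have MV: "(*v) M ` V = range ((*v) M)"
  proof -
    have "(*v) M ` V = (\<lambda>y. M *v g y) ` range ((*v) M)" by (simp add: V_def image_image)
    also have "\<dots> = (\<lambda>y. y) ` range ((*v) M)" by (rule image_cong) (use g(2) in auto)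
    finally show ?thesis by simp
  qed
  have injV: "inj_on ((*v) M) V" unfolding V_def using g(2) by (auto simp: inj_on_def)
  have dimV: "vec.dim V = rank M"
  proof -
    have eq: "vec.span V = V" using V by (simp only: vec.span_eq_iff)
    have "vec.dim ((*v) M ` V) = vec.dim V"
      by (rule vec.dim_image_eq) (simp_all only: eq injV matrix_vector_mul_linear_gen)
    then show ?thesis by (simp add: MV rank_eq_dim_range)
  qed
  \<comment> \<open>\<open>C\<close> is extended to a basis \<open>D\<close> of \<open>V\<close>;
    the vectors of \<open>D - C\<close>, at most \<open>r\<close> in number, are the only ones whose
    image under the pencil depends on the parameter.\<close>
  obtain C where C: "C \<subseteq> {v \<in> V. N *v v = 0}" "vec.independent C" "card C = vec.dim {v \<in> V. N *v v = 0}"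
    by (rule vec.basis_exists[of "{v \<in> V. N *v v = 0}"]) blast
  have "C \<subseteq> V" using C(1) by blast
  then obtain D where D: "C \<subseteq> D" "D \<subseteq> V" "vec.independent D" "V \<subseteq> vec.span D"
    by (rule vec.maximal_independent_subset_extend[OF _ C(2)])
  have finD: "finite D" using D(3) by (rule vec.finiteI_independent)
  have cardD: "card D = rank M" using vec.basis_card_eq_dim[OF D(2,4,3)] dimV by simp
  have "vec.dim ((*v) N ` V) \<le> r"
    using N unfolding rank_eq_dim_range
    by (rule order_trans[OF vec.dim_subset[OF image_mono[OF subset_UNIV]]])
  moreover have "vec.dim {v \<in> V. N *v v = 0} + vec.dim ((*v) N ` V) = vec.dim V"
    by (rule vec_dim_kernel_image[OF matrix_vector_mul_linear_gen V])
  moreover have "card (D - C) = card D - card C"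
    by (rule card_Diff_subset[OF finite_subset[OF D(1) finD] D(1)])
  ultimately have cardDC: "card (D - C) \<le> r" using C(3) dimV cardD by linarith
  define E where "E = (*v) M ` D"
  have injD: "inj_on ((*v) M) D" using injV D(2) by (rule inj_on_subset)
  have spanD: "vec.span D = V" using vec.span_minimal[OF D(2) V] D(4) by (rule equalityI)
  have indepE: "vec.independent E"
    unfolding E_def
    by (rule vec.linear_independent_injective_image
        [OF matrix_vector_mul_linear_gen D(3) injV[folded spanD]])
  obtain e :: "'m \<Rightarrow> 'a^'m" where e: "inj e" "E \<subseteq> range e" "det (\<chi> i. e i) \<noteq> 0"
    using exists_basis_matrix[OF indepE] by (elim exE conjE)
  define I where "I = {i. e i \<in> E}"
  define J where "J = {i. e i \<in> (*v) M ` (D - C)}"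
  \<comment> \<open>Rows outside \<open>I\<close> are the constant vectors \<open>e i\<close>; the
    default 0 for \<open>x i\<close> makes \<open>N *v x i\<close> vanish there.\<close>
  define x where "x i = (if i \<in> I then the_inv_into D ((*v) M) (e i) else 0)" for i
  define c where "c i = (if i \<in> I then R *v x i else e i)" for i
  have xD: "x i \<in> D" "M *v x i = e i" if "i \<in> I" for i
    using that injD by (auto simp: x_def I_def E_def the_inv_into_f_f)
  have NJ: "N *v x i = 0" if "i \<notin> J" for i
  proof (cases "i \<in> I")
    case True
    have "M *v x i \<notin> (*v) M ` (D - C)" using xD(2)[OF True] that by (simp add: J_def)
    then have "x i \<in> C" using xD(1)[OF True] by blast
    then show ?thesis using C(1) by blast
  qed (simp add: x_def)
  have "e ` I = E" using e(2) unfolding I_def by blast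
  then have "card I = card E" using card_image[OF inj_on_subset[OF e(1) subset_UNIV], of I] by simp
  then have cardI: "card I = rank M" using card_image[OF injD] cardD by (simp add: E_def)
  have "card J \<le> card ((*v) M ` (D - C))"
  proof (rule card_inj_on_le)
    show "inj_on e J" using e(1) by (rule inj_on_subset) simp
    show "e ` J \<subseteq> (*v) M ` (D - C)" unfolding J_def by blast
    show "finite ((*v) M ` (D - C))" using finD by simp
  qed
  also have "\<dots> \<le> card (D - C)" using finD by (intro card_image_le) auto
  finally have cardJ: "card J \<le> r" using cardDC by simp
  define P where "P = det (\<chi> i j. [:c i $ j, (N *v x i) $ j:])"
  have poly_P: "poly P s = det (\<chi> i. c i + s *s (N *v x i))" for s
  proof -
    have *: "(\<chi> i j. c i $ j + s * (N *v x i) $ j) = (\<chi> i. c i + s *s (N *v x i))"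
      by (simp add: vec_eq_iff)
    show ?thesis unfolding P_def poly_det by (simp flip: *)
  qed
  have "degree P \<le> (\<Sum>i\<in>UNIV. if i \<in> J then 1 else 0)"
    unfolding P_def by (rule degree_det_le) (auto simp: NJ)
  then have deg: "degree P \<le> r" using cardJ by (simp add: sum.If_cases)
  have row: "c i + s *s (N *v x i) = (R + mat_smult s N) *v x i" if "i \<in> I" for i s
    using that by (simp add: c_def matrix_vector_mult_add_rdistrib mat_smult_mult_vec)
  have "c i + t *s (N *v x i) = e i" for i
  proof (cases "i \<in> I")
    case True
    then show ?thesis using row[OF True] xD(2)[OF True] by (simp add: M_def)
  qed (simp add: c_def x_def)
  then have "poly P t \<noteq> 0" using e(3) by (simp add: poly_P)
  then have P0: "P \<noteq> 0" by auto
  have "poly P s = 0" if "s \<in> T" for s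
    unfolding poly_P
  proof (rule det_rows_eq_0)
    show "c i + s *s (N *v x i) \<in> range ((*v) (R + mat_smult s N))" if "i \<in> I" for i
      unfolding row[OF that] by (rule rangeI)
    show "vec.dim (range ((*v) (R + mat_smult s N))) < card I"
      using rk[OF that] gt cardI by (simp flip: rank_eq_dim_range)
  qed
  then have sub: "T \<subseteq> {s. poly P s = 0}" by blast
  then have "finite T" using poly_roots_finite[OF P0] finite_subset by blast
  then have "r < card T" by (rule T)
  also have "\<dots> \<le> card {s. poly P s = 0}" using sub poly_roots_finite[OF P0] by (intro card_mono)
  also have "\<dots> \<le> degree P" using P0 by (rule card_poly_roots_bound)
  finally show False using deg by simp
qed

section \<open>Base change along a field embedding\<close>

locale field_embedding =
  fixes h :: "'a::field \<Rightarrow> 'b::field"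
  assumes h_add: "h (x + y) = h x + h y" and h_mult: "h (x * y) = h x * h y" and h_one: "h 1 = 1"
begin

definition map_vec :: "'a^'n \<Rightarrow> 'b^'n" where "map_vec x = (\<chi> i. h (x $ i))"

definition map_mat :: "'a^'n^'m \<Rightarrow> 'b^'n^'m" where "map_mat A = (\<chi> i j. h (A $ i $ j))"

text \<open>The \<open>'b\<close>-linear span of the image of \<open>S\<close>, generated summand by
  summand so that a rank bound can be proved one scalar at a time.\<close>

inductive_set scalar_extension :: "('a^'n^'m) set \<Rightarrow> ('b^'n^'m) set" for S where
  zero: "0 \<in> scalar_extension S"
| step: "A \<in> S \<Longrightarrow> X \<in> scalar_extension S \<Longrightarrow> mat_smult c (map_mat A) + X \<in> scalar_extension S"

lemma h_zero [simp]: "h 0 = 0" using h_add[of 0 0] by (metis add_0 add_right_cancel)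

lemma h_eq_0_iff [simp]: "h x = 0 \<longleftrightarrow> x = 0"
proof
  assume "h x = 0"
  then show "x = 0" using h_mult[of x "inverse x"] h_one by (cases "x = 0") auto
qed simp

lemma h_minus: "h (- x) = - h x"
  using h_add[of x "- x"] by (simp add: add_eq_0_iff)

lemma inj_h: "inj h"
proof (rule injI)
  fix x y assume "h x = h y"
  then have "h (x - y) = 0" using h_add[of x "- y"] by (simp add: h_minus)
  then show "x = y" by simp
qed

lemma h_sum: "h (\<Sum>i\<in>I. f i) = (\<Sum>i\<in>I. h (f i))"
  by (induction I rule: infinite_finite_induct) (auto simp: h_add)

lemma h_prod: "h (\<Prod>i\<in>I. f i) = (\<Prod>i\<in>I. h (f i))"
  by (induction I rule: infinite_finite_induct) (auto simp: h_mult h_one)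

lemma det_map_mat: "det (map_mat A) = h (det A)"
proof -
  have "h (of_int (sign p)) = of_int (sign p)" for p :: "'c \<Rightarrow> 'c"
    by (simp add: sign_def h_one h_minus)
  then show ?thesis by (simp add: det_def map_mat_def h_sum h_mult h_prod)
qed

lemma map_mat_mult_vec: "map_mat A *v map_vec x = map_vec (A *v x)"
  by (simp add: map_mat_def map_vec_def matrix_vector_mult_def vec_eq_iff h_sum h_mult)

lemma map_vec_sum: "map_vec (\<Sum>i\<in>I. c i *s f i) = (\<Sum>i\<in>I. h (c i) *s map_vec (f i))"
  by (simp add: map_vec_def vec_eq_iff sum_component h_sum h_mult)

text \<open>Spanning relations carry over along \<open>h\<close>. Independence survives because a
  completed basis has nonzero determinant, whose image under \<open>h\<close> is the determinant of
  the image basis.\<close>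

lemma dim_map_vec: "vec.dim (map_vec ` X) = vec.dim X"
  for X :: "('a^'n) set"
proof -
  obtain B where B: "B \<subseteq> X" "vec.independent B" "X \<subseteq> vec.span B" "card B = vec.dim X"
    by (rule vec.basis_exists[of X])
  have finB: "finite B" using B(2) by (rule vec.finiteI_independent)
  have "map_vec x \<in> vec.span (map_vec ` B)" if x: "x \<in> X" for x
  proof -
    obtain c where "x = (\<Sum>b\<in>B. c b *s b)"
      using x B(3) unfolding vec.span_finite[OF finB] by blast
    then have "map_vec x = (\<Sum>b\<in>B. h (c b) *s map_vec b)" by (simp add: map_vec_sum)
    also have "\<dots> \<in> vec.span (map_vec ` B)"
      by (intro vec.span_sum vec.span_scale vec.span_base imageI)
    finally show ?thesis .
  qed
  then have span: "map_vec ` X \<subseteq> vec.span (map_vec ` B)" by blast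
  obtain e :: "'n \<Rightarrow> 'a^'n" where e: "inj e" "B \<subseteq> range e" "det (\<chi> i. e i) \<noteq> 0"
    using exists_basis_matrix[OF B(2)] by (elim exE conjE)
  have rows: "rows (map_mat (\<chi> i. e i)) = map_vec ` range e"
    by (auto simp: rows_def row_def map_mat_def map_vec_def)
  have "det (map_mat (\<chi> i. e i)) \<noteq> 0" using e(3) by (simp add: det_map_mat)
  then have "vec.span (rows (map_mat (\<chi> i. e i))) = UNIV"
    by (simp add: invertible_det_nz[symmetric] invertible_left_inverse matrix_left_invertible_span_rows_gen)
  moreover have "card (map_vec ` range e) \<le> CARD('n)"
    using card_image_le[of "UNIV :: 'n set" "map_vec \<circ> e"] by (simp add: image_comp)
  ultimately have "vec.independent (map_vec ` range e)"
    unfolding rows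
    by (intro vec.card_le_dim_spanning[of _ UNIV]) (auto simp: vec_dim_card simp del: vec.dim_UNIV)
  then have "vec.independent (map_vec ` B)"
    by (rule vec.independent_mono) (intro image_mono e(2))
  then have "card (map_vec ` B) = vec.dim (map_vec ` X)"
    using span B(1) by (intro vec.basis_card_eq_dim) auto
  moreover have "inj_on map_vec B"
    using inj_h by (auto simp: inj_on_def inj_def map_vec_def vec_eq_iff)
  ultimately show ?thesis using B(4) by (simp add: card_image)
qed

lemma rank_map_mat: "rank (map_mat A) = rank A"
proof -
  have "rows (map_mat A) = map_vec ` rows A"
    by (auto simp: rows_def row_def map_mat_def map_vec_def)
  then show ?thesis by (simp add: row_rank_def_gen dim_map_vec)
qed

lemma map_mat_in_scalar_extension:
  assumes "A \<in> S"
  shows "map_mat A \<in> scalar_extension S"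
proof -
  have "mat_smult 1 (map_mat A) + 0 = map_mat A" by (simp add: mat_smult_def vec_eq_iff)
  then show ?thesis using scalar_extension.step[OF assms scalar_extension.zero, of 1] by simp
qed

lemma subspace_scalar_extension: "matrix_subspace (scalar_extension S)"
  unfolding matrix_subspace_def
proof (intro conjI ballI allI)
  show "0 \<in> scalar_extension S" by (rule scalar_extension.zero)
  show "X + Y \<in> scalar_extension S" if "X \<in> scalar_extension S" "Y \<in> scalar_extension S" for X Y
    using that by (induction X) (auto simp: add.assoc intro: scalar_extension.step)
  show "mat_smult c X \<in> scalar_extension S" if "X \<in> scalar_extension S" for c X
    using that
  proof (induction X)
    case zero
    show ?case by (simp add: scalar_extension.zero)
  next
    case (step A X d)
    have "mat_smult c (mat_smult d (map_mat A) + X) = mat_smult (c * d) (map_mat A) + mat_smult c X"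
      by (simp add: mat_smult_def vec_eq_iff algebra_simps)
    then show ?case using step by (simp add: scalar_extension.step)
  qed
qed

text \<open>The induction allows an arbitrary added \<open>map_mat A\<close>. For \<open>c\<close>
  in the range of \<open>h\<close>, the new term is absorbed in \<open>A\<close>; that range has
  more than \<open>r\<close> elements, so \<open>rank_pencil_le\<close> extends the bound to all
  \<open>c\<close>.\<close>

lemma rank_scalar_extension_le:
  assumes S: "matrix_subspace S" and rk: "\<And>A. A \<in> S \<Longrightarrow> rank A \<le> r"
    and K: "finite (UNIV :: 'a set) \<Longrightarrow> r < card (UNIV :: 'a set)"
    and X: "X \<in> scalar_extension S"
  shows "rank X \<le> r"
proof -
  have "\<forall>A\<in>S. rank (map_mat A + X) \<le> r"
    using X
  proof (induction X)
    case zero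
    then show ?case using rk by (simp add: rank_map_mat)
  next
    case (step B X c)
    show ?case
    proof
      fix A assume A: "A \<in> S"
      have pts: "rank (map_mat A + X + mat_smult t (map_mat B)) \<le> r" if t: "t \<in> range h" for t
      proof -
        obtain s where s: "t = h s" using t by blast
        have "map_mat A + X + mat_smult t (map_mat B) = map_mat (A + mat_smult s B) + X"
          by (simp add: s mat_smult_def map_mat_def vec_eq_iff h_add h_mult)
        moreover have "A + mat_smult s B \<in> S"
          using S A step.hyps(1) by (simp add: matrix_subspace_def)
        ultimately show ?thesis using step.IH by metis
      qed
      have card: "r < card (range h)" if "finite (range h)"
        using that K finite_imageD[OF _ inj_h] by (simp add: card_image inj_h)
      have "rank (map_mat B) \<le> r" using rk[OF step.hyps(1)] by (simp add: rank_map_mat)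
      then have "rank (map_mat A + X + mat_smult c (map_mat B)) \<le> r"
        by (rule rank_pencil_le[OF _ card pts])
      then show "rank (map_mat A + (mat_smult c (map_mat B) + X)) \<le> r" by (simp add: ac_simps)
    qed
  qed
  then have "rank (map_mat 0 + X) \<le> r" using S by (simp add: matrix_subspace_def)
  moreover have "map_mat 0 + X = X" by (simp add: map_mat_def vec_eq_iff)
  ultimately show ?thesis by simp
qed

end

subsection \<open>Semi-primitive spaces\<close>

definition const_fract :: "'a::field \<Rightarrow> 'a poly fract" where
  "const_fract c = Fract [:c:] 1"

lemma field_embedding_const_fract: "field_embedding const_fract"
  by unfold_locales (auto simp: const_fract_def one_pCons One_fract_def mult.commute)

lemma infinite_UNIV_poly_fract: "infinite (UNIV :: 'a::field poly fract set)"
proof -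
  have "inj (\<lambda>n. Fract (monom (1::'a) n) 1)"
    by (rule injI) (simp add: eq_fract monom_eq_iff')
  then show ?thesis unfolding infinite_iff_countable_subset by blast
qed

lemma finite_ranks: "finite {rank A | A. A \<in> S}" for S :: "('a::field^'n^'m) set"
proof (rule finite_subset)
  have "rank A \<le> CARD('n)" for A :: "'a^'n^'m"
    using dim_kernel_plus_rank[of A] by linarith
  then show "{rank A | A. A \<in> S} \<subseteq> {..CARD('n)}" by auto
qed simp

lemma trk_le:
  fixes S :: "('a::field^'n^'m) set"
  assumes "\<And>x. vec.dim (eval_space S x) \<le> b"
  shows "trk S \<le> b"
proof -
  have eq: "{A *v x |A. A \<in> S} = eval_space S x" for x
    by (auto simp: eval_space_def)
  have "{vec.dim (eval_space S x) |x. True} \<subseteq> {..b}" using assms by auto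
  then have "finite {vec.dim (eval_space S x) |x. True}" by (rule finite_subset) simp
  then show ?thesis
    unfolding trk_def eq by (rule Max.boundedI) (use assms in blast)+
qed

text \<open>Otherwise the kernels of all matrices of rank \<open>r\<close> lie in a hyperplane
  \<open>U\<close>. Restriction to \<open>U\<close> leaves these kernels unchanged, and a matrix of
  smaller rank keeps a kernel of dimension at least (n - 1) - (r - 1) in \<open>U\<close>. So none
  drops below n - r, which is at least the defectiveness index.\<close>

lemma span_kernels_of_semi_primitive:
  fixes S :: "('a::field^'n^'m) set"
  assumes sp: "semi_primitive S" and r: "r = urk S" and S: "matrix_subspace S"
  shows "vec.span {z. \<exists>A\<in>S. rank A = r \<and> A *v z = 0} = UNIV"
proof (rule ccontr)
  let ?Z = "{z. \<exists>A\<in>S. rank A = r \<and> A *v z = 0}"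
  assume neq: "vec.span ?Z \<noteq> UNIV"
  have rk: "rank A \<le> r" if "A \<in> S" for A
    unfolding r urk_def using that by (intro Max_ge finite_ranks) blast
  have "r \<in> {rank A | A. A \<in> S}"
    unfolding r urk_def using S by (intro Max_in finite_ranks) (auto simp: matrix_subspace_def)
  then obtain M where M: "M \<in> S" "rank M = r" by blast
  \<comment> \<open>\<open>GREATEST\<close> needs a witness and a bound; the dimension of a single
    kernel bounds the admissible \<open>c\<close>.\<close>
  have "defective S (defectiveness_index S)"
    unfolding defectiveness_index_def
  proof (rule GreatestI_nat)
    show "defective S 0" by (simp add: defective_def)
    show "c \<le> CARD('n)" if "defective S c" for c
    proof -
      have "c \<le> vec.dim (mker M)" using that M(1) by (simp add: defective_def)
      also have "\<dots> \<le> CARD('n)" by (rule dim_subset_UNIV_cart_gen)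
      finally show ?thesis .
    qed
  qed
  then have "defectiveness_index S \<le> vec.dim (mker M)" using M(1) by (simp add: defective_def)
  then have idx: "defectiveness_index S + r \<le> CARD('n)"
    using dim_kernel_plus_rank[of M] M(2) by (simp add: mker_def)
  obtain B where B: "B \<subseteq> vec.span ?Z" "vec.independent B" "vec.span ?Z \<subseteq> vec.span B" "card B = vec.dim (vec.span ?Z)"
    by (rule vec.basis_exists)
  obtain C where C: "B \<subseteq> C" "vec.independent C" "UNIV \<subseteq> vec.span C"
    by (rule vec.maximal_independent_subset_extend[OF subset_UNIV B(2)]) blast
  have finC: "finite C" using C(2) by (rule vec.finiteI_independent)
  have cardC: "card C = CARD('n)"
    using vec.basis_card_eq_dim[OF subset_UNIV C(3,2)] by (simp add: vec_dim_card del: vec.dim_UNIV)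
  have "C \<noteq> B"
  proof
    assume "C = B"
    then have "UNIV \<subseteq> vec.span ?Z"
      using C(3) B(1) vec.span_minimal[OF B(1)] by simp
    then show False using neq by blast
  qed
  then obtain a where a: "a \<in> C" "a \<notin> B" using C(1) by blast
  \<comment> \<open>Dropping from a basis of the whole space a vector outside the basis of
    \<open>vec.span ?Z\<close> leaves a hyperplane that contains \<open>?Z\<close>.\<close>
  define U where "U = vec.span (C - {a})"
  have U: "vec.subspace U" unfolding U_def by simp
  have "vec.independent (C - {a})" using C(2) vec.independent_mono by blast
  then have dimU: "vec.dim U + 1 = CARD('n)"
    unfolding U_def using finC a(1) cardC card_Suc_Diff1[OF finC a(1)]
    by (simp add: vec.dim_eq_card_independent del: card_Diff_insert)
  have "B \<subseteq> C - {a}" using C(1) a(2) by blast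
  then have "vec.span B \<subseteq> U" unfolding U_def by (rule vec.span_mono)
  then have ZU: "?Z \<subseteq> U" using B(3) vec.span_superset[of ?Z] by blast
  have "vec.dim (mker A \<inter> U) \<ge> defectiveness_index S" if A: "A \<in> S" for A
  proof (cases "rank A = r")
    case True
    then have "mker A \<inter> U = mker A" using A ZU by (auto simp: mker_def)
    then show ?thesis using dim_kernel_plus_rank[of A] True idx by (simp add: mker_def)
  next
    case False
    then have lt: "rank A < r" using rk[OF A] by simp
    have "vec.dim {v \<in> U. A *v v = 0} + vec.dim ((*v) A ` U) = vec.dim U"
      by (rule vec_dim_kernel_image[OF matrix_vector_mul_linear_gen U])
    moreover have "vec.dim ((*v) A ` U) \<le> rank A"
      unfolding rank_eq_dim_range by (rule vec.dim_subset) blast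
    moreover have "mker A \<inter> U = {v \<in> U. A *v v = 0}" by (auto simp: mker_def)
    ultimately show ?thesis using lt idx dimU by simp
  qed
  then have "linear_hyperplane U \<and> restricted_defective S U (defectiveness_index S)"
    using U dimU by (simp add: linear_hyperplane_def restricted_defective_def)
  then show False using sp unfolding semi_primitive_def by blast
qed

theorem mainTheorem8:
  fixes S :: "('a::field^'n^'m) set"
  assumes "matrix_subspace S"
    and "semi_primitive S"
    and "r = urk S"
    and "finite (UNIV :: 'a set) \<Longrightarrow> r < card (UNIV :: 'a set)"
    and "r \<ge> 2"
  shows "trk S \<le> 6 + ((r - 2) choose 2)"
proof -
  interpret field_embedding "const_fract :: 'a \<Rightarrow> 'a poly fract"
    by (rule field_embedding_const_fract)
  let ?L = "scalar_extension S"
  have rk: "rank A \<le> r" if "A \<in> S" for A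
    unfolding assms(3) urk_def using that by (intro Max_ge finite_ranks) blast
  have rkL: "rank X \<le> r" if "X \<in> ?L" for X
    using rank_scalar_extension_le[OF assms(1) rk assms(4) that] by blast
  let ?Z = "{z. \<exists>A\<in>S. rank A = r \<and> A *v z = 0}" and ?ZL = "{z. \<exists>A\<in>?L. rank A = r \<and> A *v z = 0}"
  \<comment> \<open>Semi-primitivity itself is not transferred to K(t): it suffices that kernel
    vectors of matrices of rank \<open>r\<close> remain such vectors and that \<open>map_vec\<close>
    preserves dimension.\<close>
  have "map_vec ` ?Z \<subseteq> ?ZL"
  proof (rule image_subsetI)
    fix z assume "z \<in> ?Z"
    then obtain A where A: "A \<in> S" "rank A = r" "A *v z = 0" by blast
    have "map_mat A *v map_vec z = 0" by (simp add: map_mat_mult_vec A(3)) (simp add: map_vec_def vec_eq_iff)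
    then show "map_vec z \<in> ?ZL"
      using map_mat_in_scalar_extension[OF A(1)] A(2) rank_map_mat[of A] by blast
  qed
  moreover have "vec.dim ?Z = CARD('n)"
    using span_kernels_of_semi_primitive[OF assms(2,3,1)] vec.dim_span[of ?Z]
    by (simp add: vec_dim_card del: vec.dim_UNIV vec.dim_span)
  ultimately have "CARD('n) \<le> vec.dim ?ZL"
    using vec.dim_subset[of "map_vec ` ?Z" ?ZL] dim_map_vec[of ?Z] by simp
  then have "vec.span ?ZL = UNIV"
    by (intro vec.subspace_dim_equal) (simp_all add: vec_dim_card del: vec.dim_UNIV)
  then obtain d where d: "d \<le> r" "\<And>x. vec.dim (eval_space ?L x) \<le> (r + 1 - d) * d"
    using dim_eval_space_le_infinite[OF infinite_UNIV_poly_fract subspace_scalar_extension rkL] by blast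
  have "vec.dim (eval_space S x) \<le> 6 + ((r - 2) choose 2)" for x
  proof -
    have "map_vec ` eval_space S x \<subseteq> eval_space ?L (map_vec x)"
      using map_mat_in_scalar_extension[of _ S] by (auto simp: eval_space_def map_mat_mult_vec[symmetric])
    then have "vec.dim (eval_space S x) \<le> vec.dim (eval_space ?L (map_vec x))"
      using vec.dim_subset[of "map_vec ` eval_space S x"] dim_map_vec[of "eval_space S x"] by simp
    also have "\<dots> \<le> (r + 1 - d) * d" by (rule d(2))
    also have "\<dots> \<le> 6 + ((r - 2) choose 2)" by (rule square_bound_le_binomial[OF d(1) assms(5)])
    finally show ?thesis .
  qed
  then show ?thesis by (rule trk_le)
qed

end
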